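(* Let $k\ge 1$, $n\ge 2$, and let $K_1,K_2\subset\mathbb{R}^k$ be fractal $k$-cubes of order $n$ with digit sets $D_1,D_2\subset\{0,1,\dots,n-1\}^k$. For $\alpha\in A_k=\{-1,0,1\}^k$ put $F_\alpha=K_1\cap(K_2+\alpha)$. Then the family $\{F_\alpha:\alpha\in A_k\}$ satisfies the system of equations $$F_\alpha=\bigcup_{\beta\sqsupseteq\alpha}T_{\alpha\beta}(F_\beta),\qquad \alpha\in A_k,$$ where for any $\beta\sqsupseteq\alpha$, $$T_{\alpha\beta}(F_\beta)=\tfrac1n\,(F_\beta+G_{\alpha\beta})\quad\text{and}\quad G_{\alpha\beta}=D_1\cap(D_2+n\alpha-\beta).$$
   Context: A fractal $k$-cube of order $n$ with (nonempty) digit set $D\subset\{0,1,\dots,n-1\}^k$ is the attractor $K$ of the system of contractions $S_d(x)=\frac1n(x+d)$, $d\in D$, on $\mathbb{R}^k$, i.e. the unique nonempty compact set $K\subset\mathbb{R}^k$ with $K=\frac1n(K+D)$. Sums of sets are Minkowski sums: $X+Y=\{x+y:x\in X,y\in Y\}$ (empty if $X$ or $Y$ is empty), and $X+v=\{x+v:x\in X\}$ for a vector $v$. For $\alpha,\beta\in A_k=\{-1,0,1\}^k$, write $\alpha\sqsubseteq\beta$ (equivalently $\beta\sqsupseteq\alpha$) if $\beta_i=\alpha_i$ for every coordinate $i$ with $\alpha_i\ne0$. *)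

theory Defs
  imports "HOL-Analysis.Analysis" "HOL-Library.Set_Algebras"
begin

(* Minkowski sums are those of HOL-Library.Set_Algebras: X + Y for two sets, and
   v +o X = {v + x | x. x \<in> X} for a translate by a vector. *)

definition digit_cube :: "nat \<Rightarrow> (real ^ 'k) set" where
  "digit_cube n = {d. \<forall>i. d $ i \<in> real ` {0..<n}}"

(* The right-hand side of the set equation K = (1/n) (K + D), as an operator on sets. *)
definition scaled_sum :: "nat \<Rightarrow> (real ^ 'k) set \<Rightarrow> (real ^ 'k) set \<Rightarrow> (real ^ 'k) set" where
  "scaled_sum n X D = (\<lambda>x. (1 / real n) *\<^sub>R x) ` (X + D)"

definition fractal_cube :: "nat \<Rightarrow> (real ^ 'k) set \<Rightarrow> (real ^ 'k) set \<Rightarrow> bool" where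
  "fractal_cube n D K \<longleftrightarrow>
     D \<noteq> {} \<and> D \<subseteq> digit_cube n \<and> compact K \<and> K \<noteq> {} \<and> K = scaled_sum n K D"

definition sign_vectors :: "(real ^ 'k) set" where
  "sign_vectors = {\<alpha>. \<forall>i. \<alpha> $ i \<in> {-1, 0, 1}}"

definition sign_le :: "real ^ 'k \<Rightarrow> real ^ 'k \<Rightarrow> bool"  (infix \<open>\<sqsubseteq>\<close> 50) where
  "\<alpha> \<sqsubseteq> \<beta> \<longleftrightarrow> (\<forall>i. \<alpha> $ i \<noteq> 0 \<longrightarrow> \<beta> $ i = \<alpha> $ i)"

definition F_set :: "(real ^ 'k) set \<Rightarrow> (real ^ 'k) set \<Rightarrow> real ^ 'k \<Rightarrow> (real ^ 'k) set" where
  "F_set K1 K2 \<alpha> = K1 \<inter> (\<alpha> +o K2)"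

definition G_set :: "nat \<Rightarrow> (real ^ 'k) set \<Rightarrow> (real ^ 'k) set \<Rightarrow> real ^ 'k \<Rightarrow> real ^ 'k \<Rightarrow> (real ^ 'k) set" where
  "G_set n D1 D2 \<alpha> \<beta> = D1 \<inter> ((real n *\<^sub>R \<alpha> - \<beta>) +o D2)"

definition T_map :: "nat \<Rightarrow> (real ^ 'k) set \<Rightarrow> (real ^ 'k) set \<Rightarrow> real ^ 'k \<Rightarrow> real ^ 'k
    \<Rightarrow> (real ^ 'k) set \<Rightarrow> (real ^ 'k) set" where
  "T_map n D1 D2 \<alpha> \<beta> X = scaled_sum n X (G_set n D1 D2 \<alpha> \<beta>)"

(* The predicate fractal_cube n D pins down exactly one set, the attractor. *)

lemma mem_scaled_sum:
  assumes "n > 0"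
  shows "x \<in> scaled_sum n X D \<longleftrightarrow> (\<exists>d\<in>D. real n *\<^sub>R x - d \<in> X)"
proof
  assume "x \<in> scaled_sum n X D"
  then obtain y d where "y \<in> X" "d \<in> D" "x = (1 / real n) *\<^sub>R (y + d)"
    unfolding scaled_sum_def set_plus_def by auto
  with assms show "\<exists>d\<in>D. real n *\<^sub>R x - d \<in> X"
    by (intro bexI[of _ d]) auto
next
  assume "\<exists>d\<in>D. real n *\<^sub>R x - d \<in> X"
  then obtain d where d: "d \<in> D" "real n *\<^sub>R x - d \<in> X" by blast
  have "real n *\<^sub>R x - d + d \<in> X + D" using d by (intro set_plus_intro)
  moreover have "x = (1 / real n) *\<^sub>R (real n *\<^sub>R x - d + d)" using assms by simp
  ultimately show "x \<in> scaled_sum n X D" unfolding scaled_sum_def by blast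
qed

lemma fractal_cube_subset:
  fixes K L :: "(real ^ 'k) set"
  assumes n: "n \<ge> 2" and K: "fractal_cube n D K" and L: "fractal_cube n D L"
  shows "K \<subseteq> L"
proof -
  have cK: "compact K" "K \<noteq> {}" "K = scaled_sum n K D"
   and cL: "compact L" "L \<noteq> {}" "L = scaled_sum n L D"
    using K L unfolding fractal_cube_def by auto
  have "continuous_on K (\<lambda>x. infdist x L)" by (intro continuous_intros)
  then obtain x where x: "x \<in> K" "\<And>y. y \<in> K \<Longrightarrow> infdist y L \<le> infdist x L"
    using continuous_attains_sup[OF cK(1,2)] by blast
  obtain d where d: "d \<in> D" "real n *\<^sub>R x - d \<in> K"
    using x(1) cK(3) mem_scaled_sum[of n x K D] n by auto
  obtain z where z: "z \<in> L" "infdist (real n *\<^sub>R x - d) L = dist (real n *\<^sub>R x - d) z"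
    using infdist_attains_inf[OF compact_imp_closed[OF cL(1)] cL(2)] by blast
  let ?w = "(1 / real n) *\<^sub>R (z + d)"
  have "?w \<in> scaled_sum n L D"
    unfolding scaled_sum_def using z(1) d(1) by blast
  then have "?w \<in> L" using cL(3) by simp
  then have "infdist x L \<le> dist x ?w" by (rule infdist_le)
  then have "real n * infdist x L \<le> real n * dist x ?w" using n by simp
  also have "\<dots> = norm (real n *\<^sub>R (x - ?w))" by (simp add: dist_norm)
  also have "real n *\<^sub>R (x - ?w) = real n *\<^sub>R x - d - z"
    using n by (simp add: algebra_simps)
  also have "norm (real n *\<^sub>R x - d - z) = infdist (real n *\<^sub>R x - d) L"
    using z(2) by (simp add: dist_norm)
  also have "\<dots> \<le> infdist x L" using x(2) d(2) by blast
  finally have "(real n - 1) * infdist x L \<le> 0" by (simp add: algebra_simps)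
  then have "infdist x L \<le> 0" using n by (simp add: mult_le_0_iff)
  then have "infdist y L = 0" if "y \<in> K" for y
    using x(2)[OF that] infdist_nonneg[of y L] by linarith
  then show ?thesis
    using in_closed_iff_infdist_zero[OF compact_imp_closed[OF cL(1)] cL(2)] by blast
qed

lemma finite_digit_cube: "finite (digit_cube n :: (real ^ 'k) set)"
proof -
  have "digit_cube n \<subseteq> vec_lambda ` (UNIV \<rightarrow> real ` {0..<n} :: ('k \<Rightarrow> real) set)"
    unfolding digit_cube_def by (auto intro!: image_eqI[where x = "vec_nth _"])
  moreover have "finite (UNIV \<rightarrow> real ` {0..<n} :: ('k \<Rightarrow> real) set)"
    using finite_PiE[of "UNIV :: 'k set" "\<lambda>_. real ` {0..<n}"] by (simp add: PiE_UNIV_domain Pi_def)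
  ultimately show ?thesis by (meson finite_imageI finite_subset)
qed

theorem fractal_cube_unique_exists:
  fixes D :: "(real ^ 'k) set"
  assumes n: "n \<ge> 2" and D: "D \<noteq> {}" "D \<subseteq> digit_cube n"
  shows "\<exists>!K. fractal_cube n D K"
proof -
  have n0: "n > 0" using n by simp
  have finD: "finite D" using D(2) finite_digit_cube finite_subset by blast
  define H where "H m = ((\<lambda>X. scaled_sum n X D) ^^ m) (cbox 0 (1 :: real ^ 'k))" for m
  have H_Suc: "H (Suc m) = scaled_sum n (H m) D" for m by (simp add: H_def)
  have mono: "scaled_sum n X D \<subseteq> scaled_sum n Y D" if "X \<subseteq> Y" for X Y
    using that unfolding subset_iff mem_scaled_sum[OF n0] by blast
  have step0: "H (Suc 0) \<subseteq> H 0"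
  proof
    fix x assume "x \<in> H (Suc 0)"
    then have "x \<in> scaled_sum n (cbox 0 1) D" by (simp add: H_def)
    then obtain d where d: "d \<in> D" "real n *\<^sub>R x - d \<in> cbox 0 1"
      unfolding mem_scaled_sum[OF n0] by blast
    have "0 \<le> x $ i \<and> x $ i \<le> 1" for i
    proof -
      obtain j where j: "d $ i = real j" "j < n"
        using d(1) D(2) unfolding digit_cube_def by fastforce
      have "0 \<le> real n * x $ i - real j" "real n * x $ i - real j \<le> 1"
        using d(2) unfolding j(1)[symmetric] by (simp_all add: mem_box_cart)
      moreover have "real j + 1 \<le> real n" using j(2) by linarith
      ultimately have "0 \<le> real n * x $ i" "real n * x $ i \<le> real n * 1" by linarith+
      then show ?thesis using n0 by (simp add: zero_le_mult_iff)
    qed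
    then show "x \<in> H 0" by (simp add: H_def mem_box_cart)
  qed
  have step: "H (Suc m) \<subseteq> H m" for m
  proof (induction m)
    case 0 show ?case by (rule step0)
  next
    case (Suc m) show ?case using mono[OF Suc.IH] by (simp only: H_Suc)
  qed
  have dec: "H m' \<subseteq> H m" if "m \<le> m'" for m m'
    using lift_Suc_antimono_le[of H, OF step that] .
  have comp: "compact (H m)" for m
  proof (induction m)
    case 0 then show ?case by (simp add: H_def)
  next
    case (Suc m)
    have "compact (H m + D)"
      using compact_sums[OF Suc finite_imp_compact[OF finD]]
      by (simp add: set_plus_def) (smt (verit) Collect_cong)
    then show ?case unfolding H_Suc scaled_sum_def by (rule compact_scaling)
  qed
  have ne: "H m \<noteq> {}" for m
  proof (induction m)
    case 0
    have "0 \<in> cbox 0 (1 :: real ^ 'k)" by (simp add: mem_box_cart)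
    then show ?case unfolding H_def by auto
  next
    case (Suc m) then show ?case using D(1) unfolding H_Suc scaled_sum_def set_plus_def by auto
  qed
  define K where "K = (\<Inter>m. H m)"
  have "compact K" unfolding K_def
    using comp by (intro compact_Inter) auto
  moreover have "K \<noteq> {}" unfolding K_def
    using compact_nest[of H] comp ne dec by blast
  moreover have "K = scaled_sum n K D"
  proof
    show "scaled_sum n K D \<subseteq> K"
    proof -
      have "scaled_sum n K D \<subseteq> H (Suc m)" for m
        unfolding H_Suc by (rule mono) (auto simp: K_def)
      then show ?thesis unfolding K_def using step by blast
    qed
    show "K \<subseteq> scaled_sum n K D"
    proof
      fix x assume "x \<in> K"
      then have "x \<in> H (Suc m)" for m by (simp add: K_def)
      then have ex: "\<forall>m. \<exists>d. d \<in> D \<and> real n *\<^sub>R x - d \<in> H m"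
        using mem_scaled_sum[OF n0] unfolding H_Suc by blast
      have "\<exists>d\<in>D. \<forall>m. real n *\<^sub>R x - d \<in> H m"
      proof (rule ccontr)
        assume "\<not> ?thesis"
        then have "\<forall>d\<in>D. \<exists>m. real n *\<^sub>R x - d \<notin> H m" by blast
        then obtain f where f: "\<And>d. d \<in> D \<Longrightarrow> real n *\<^sub>R x - d \<notin> H (f d)" by metis
        obtain d where d: "d \<in> D" "real n *\<^sub>R x - d \<in> H (Max (f ` D))" using ex by blast
        have "f d \<le> Max (f ` D)" using finD d(1) by simp
        then show False using dec d f by blast
      qed
      then show "x \<in> scaled_sum n K D"
        unfolding mem_scaled_sum[OF n0] K_def by blast
    qed
  qed
  ultimately have "fractal_cube n D K" using D by (simp add: fractal_cube_def)
  then show ?thesis using fractal_cube_subset[OF n] by blast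
qed

end

(* If x lies in F_alpha, then n x - d1 \<in> K1 and n (x - alpha) - d2 \<in> K2 for some digits d1, d2.
   These two points differ by beta = n alpha + d2 - d1. Both lie in the unit cube, so the integer
   coordinates of beta have absolute value at most 1, and since |d2 - d1| \<le> n - 1 coordinatewise,
   a nonzero coordinate of alpha forces the same coordinate of beta. *)

theory Submission imports Defs begin

lemma fractal_cube_step:
  assumes "n > 0" and "fractal_cube n D K"
  shows "x \<in> K \<longleftrightarrow> (\<exists>d\<in>D. real n *\<^sub>R x - d \<in> K)"
proof -
  have "K = scaled_sum n K D" using assms(2) unfolding fractal_cube_def by blast
  then show ?thesis using mem_scaled_sum[OF assms(1), of x K D] by metis
qed

lemma digit_cubeE:
  assumes "d \<in> digit_cube n"
  obtains j where "d $ i = real j" "j < n"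
  using assms unfolding digit_cube_def by fastforce

text \<open>By compactness the coordinate \<open>x $ i\<close> attains its extrema on
  \<open>K\<close>. At a maximum, n x_i = y_i + j with y_i at most x_i and j at most n - 1, so (n -
  1) x_i is at most n - 1; at a minimum, y_i is at least x_i and j is nonnegative. Dividing by n - 1
  > 0 gives both bounds.\<close>

lemma fractal_cube_unit_cube:
  fixes K :: "(real ^ 'k) set"
  assumes n: "n \<ge> 2" and K: "fractal_cube n D K" and z: "z \<in> K"
  shows "0 \<le> z $ i" and "z $ i \<le> 1"
proof -
  have cK: "compact K" "K \<noteq> {}" and D: "D \<subseteq> digit_cube n"
    using K unfolding fractal_cube_def by auto
  have cont: "continuous_on K (\<lambda>x. x $ i)" by (intro continuous_intros)
  have step: "\<exists>y\<in>K. \<exists>j<n. real n * x $ i = y $ i + real j" if x: "x \<in> K" for x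
  proof -
    obtain d where d: "d \<in> D" "real n *\<^sub>R x - d \<in> K"
      using fractal_cube_step[OF _ K, of x] n x by auto
    obtain j where j: "d $ i = real j" "j < n" using d(1) D digit_cubeE by blast
    show ?thesis using d(2) j
      by (intro bexI[of _ "real n *\<^sub>R x - d"] exI[of _ j]) auto
  qed
  show "z $ i \<le> 1"
  proof -
    obtain x where x: "x \<in> K" "\<And>y. y \<in> K \<Longrightarrow> y $ i \<le> x $ i"
      using continuous_attains_sup[OF cK cont] by blast
    obtain y j where y: "y \<in> K" "j < n" "real n * x $ i = y $ i + real j"
      using step[OF x(1)] by blast
    have "real j \<le> real n - 1" using y(2) by linarith
    then have "(real n - 1) * x $ i \<le> (real n - 1) * 1"
      using x(2)[OF y(1)] y(3) by (simp add: algebra_simps)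
    then have "x $ i \<le> 1" using n by simp
    then show ?thesis using x(2)[OF z] by linarith
  qed
  show "0 \<le> z $ i"
  proof -
    obtain x where x: "x \<in> K" "\<And>y. y \<in> K \<Longrightarrow> x $ i \<le> y $ i"
      using continuous_attains_inf[OF cK cont] by blast
    obtain y j where y: "y \<in> K" "j < n" "real n * x $ i = y $ i + real j"
      using step[OF x(1)] by blast
    have "0 \<le> (real n - 1) * x $ i"
      using x(2)[OF y(1)] y(3) by (simp add: algebra_simps)
    then have "0 \<le> x $ i" using n by (simp add: zero_le_mult_iff)
    then show ?thesis using x(2)[OF z] by linarith
  qed
qed

text \<open>Membership of d1 in \<open>G_set\<close> supplies a digit d2 with d1 = d2 + n \<alpha> -
  \<beta>. Naming d2 makes \<beta> a function of the two digits, and the remaining conditions no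
  longer mention \<beta>, so the union over \<beta> can be compared with \<open>F_set\<close> at
  \<alpha>.\<close>

lemma mem_T_map_iff:
  assumes "n > 0"
  shows "x \<in> T_map n D1 D2 \<alpha> \<beta> (F_set K1 K2 \<beta>) \<longleftrightarrow>
    (\<exists>d1\<in>D1. \<exists>d2\<in>D2. \<beta> = real n *\<^sub>R \<alpha> + d2 - d1 \<and>
      real n *\<^sub>R x - d1 \<in> K1 \<and> real n *\<^sub>R (x - \<alpha>) - d2 \<in> K2)"
    (is "?L \<longleftrightarrow> ?R")
proof -
  \<comment> \<open>Undoing the translation of K2 by \<beta> lands on the point that the second
    digit d2 = d - (n \<alpha> - \<beta>) produces from x - \<alpha>.\<close>
  have shift: "real n *\<^sub>R x - d - \<beta> = real n *\<^sub>R (x - \<alpha>) - (d - (real n *\<^sub>R \<alpha> - \<beta>))" for d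
    by (simp add: algebra_simps)
  have "?L \<longleftrightarrow> (\<exists>d1\<in>D1. d1 - (real n *\<^sub>R \<alpha> - \<beta>) \<in> D2 \<and> real n *\<^sub>R x - d1 \<in> K1 \<and>
      real n *\<^sub>R (x - \<alpha>) - (d1 - (real n *\<^sub>R \<alpha> - \<beta>)) \<in> K2)"
    unfolding T_map_def mem_scaled_sum[OF assms] G_set_def F_set_def Bex_def Int_iff
      set_minus_plus[symmetric]
      shift
    by blast
  moreover have "\<beta> = real n *\<^sub>R \<alpha> + d2 - d1 \<longleftrightarrow> d2 = d1 - (real n *\<^sub>R \<alpha> - \<beta>)" for d1 d2
    by (auto simp: algebra_simps)
  ultimately show ?thesis by auto
qed

text \<open>As j2 - j1 lies between -(n - 1) and n - 1, a = 1 gives b at least 1 and a = -1 gives b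
  at most -1; the bound on b then leaves only b = a.\<close>

lemma digit_difference_sign:
  fixes a b :: int and j1 j2 n :: nat
  assumes "a \<in> {-1, 0, 1}" "j1 < n" "j2 < n" "b = int n * a + int j2 - int j1" "\<bar>b\<bar> \<le> 1"
  shows "b \<in> {-1, 0, 1}" and "a \<noteq> 0 \<Longrightarrow> b = a"
  using assms by auto

theorem theorem7:
  fixes n :: nat and D1 D2 K1 K2 :: "(real ^ 'k) set"
  assumes "n \<ge> 2"
    and "fractal_cube n D1 K1"
    and "fractal_cube n D2 K2"
  shows "\<forall>\<alpha>\<in>sign_vectors.
           F_set K1 K2 \<alpha> = (\<Union>\<beta>\<in>{\<beta>\<in>sign_vectors. \<alpha> \<sqsubseteq> \<beta>}. T_map n D1 D2 \<alpha> \<beta> (F_set K1 K2 \<beta>))"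
proof (intro ballI set_eqI)
  fix \<alpha> x :: "real ^ 'k"
  assume \<alpha>: "\<alpha> \<in> sign_vectors"
  have n0: "n > 0" using assms(1) by simp
  note step1 = fractal_cube_step[OF n0 assms(2)] and step2 = fractal_cube_step[OF n0 assms(3)]
  \<comment> \<open>The self-similarity of each cube is applied once, at x and at x - \<alpha>; the
    two digits are chosen independently.\<close>
  have F: "x \<in> F_set K1 K2 \<alpha> \<longleftrightarrow>
    (\<exists>d1\<in>D1. \<exists>d2\<in>D2. real n *\<^sub>R x - d1 \<in> K1 \<and> real n *\<^sub>R (x - \<alpha>) - d2 \<in> K2)"
    unfolding F_set_def Int_iff set_minus_plus[symmetric] step1[of x] step2[of "x - \<alpha>"] by blast
  have \<beta>: "real n *\<^sub>R \<alpha> + d2 - d1 \<in> {\<beta>\<in>sign_vectors. \<alpha> \<sqsubseteq> \<beta>}"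
    if d: "d1 \<in> D1" "d2 \<in> D2" and K: "real n *\<^sub>R x - d1 \<in> K1" "real n *\<^sub>R (x - \<alpha>) - d2 \<in> K2"
    for d1 d2
  proof -
    let ?\<beta> = "real n *\<^sub>R \<alpha> + d2 - d1"
    have "?\<beta> $ i \<in> {-1, 0, 1} \<and> (\<alpha> $ i \<noteq> 0 \<longrightarrow> ?\<beta> $ i = \<alpha> $ i)" for i
    proof -
      obtain j1 j2 where j: "d1 $ i = real j1" "j1 < n" "d2 $ i = real j2" "j2 < n"
        using d assms(2,3) unfolding fractal_cube_def by (meson digit_cubeE subsetD)
      \<comment> \<open>Passing to integers matters: a real number of absolute value at most 1 need
        not be -1, 0 or 1.\<close>
      have "\<alpha> $ i \<in> of_int ` {-1, 0, 1}" using \<alpha> unfolding sign_vectors_def by auto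
      then obtain a :: int where a: "\<alpha> $ i = of_int a" "a \<in> {-1, 0, 1}" by blast
      define b where "b = int n * a + int j2 - int j1"
      have b: "?\<beta> $ i = of_int b" by (simp add: b_def a(1) j)
      \<comment> \<open>The terms n x cancel, leaving a difference of two numbers in [0, 1].\<close>
      have "?\<beta> $ i = (real n *\<^sub>R x - d1) $ i - (real n *\<^sub>R (x - \<alpha>) - d2) $ i"
        by (simp add: algebra_simps)
      then have "\<bar>?\<beta> $ i\<bar> \<le> 1"
        using fractal_cube_unit_cube[OF assms(1,2) K(1), of i]
          fractal_cube_unit_cube[OF assms(1,3) K(2), of i] by linarith
      then have "\<bar>b\<bar> \<le> 1" unfolding b by linarith
      note digit_difference_sign[OF a(2) j(2,4) b_def this]
      then show ?thesis unfolding b a(1) by auto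
    qed
    then show ?thesis unfolding sign_vectors_def sign_le_def by blast
  qed
  \<comment> \<open>Both sides now ask for the same pair of digits. Only the inclusion into the
    union needs the fact \<open>\<beta>\<close>, to place the index in its range.\<close>
  show "x \<in> F_set K1 K2 \<alpha> \<longleftrightarrow>
    x \<in> (\<Union>\<beta>\<in>{\<beta>\<in>sign_vectors. \<alpha> \<sqsubseteq> \<beta>}. T_map n D1 D2 \<alpha> \<beta> (F_set K1 K2 \<beta>))"
    unfolding UN_iff mem_T_map_iff[OF n0] F using \<beta> by blast
qed

end
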